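(* Let $(X,f_{1,\infty})$ be an NDS with $f_{1,\infty}$ feeble open. Let $f:X\to X$ be a continuous map and suppose that $\{f_n^{k}\}_{k\in\mathbb{N}}$ converges collectively to $\{f^k\}_{k\in\mathbb{N}}$. If $f_{1,\infty}$ is syndetically transitive and, in addition, is weakly mixing or thickly transitive, then $f_{1,\infty}$ is thickly syndetically transitive and multi-transitive.
   Context: $\mathbb{N}=\{1,2,3,\dots\}$. A non-autonomous discrete dynamical system (NDS) $(X,f_{1,\infty})$ consists of a compact metric space $(X,d)$ and a sequence $f_{1,\infty}=\{f_n\}_{n=1}^\infty$ of continuous maps $f_n:X\to X$. For $i,n\in\mathbb{N}$, $f_i^n:=f_{i+(n-1)}\circ\cdots\circ f_i$, and $f_i^0=\mathrm{id}_X$. $f_{1,\infty}$ is feeble open if $\mathrm{int}(f_i(U))\neq\emptyset$ for every nonempty open $U\subseteq X$ and every $i\in\mathbb{N}$. Collective convergence: with $D(f,g)=\sup_{x\in X}d(f(x),g(x))$, $\{f_n^{k}\}_{k\in\mathbb{N}}$ converges collectively to $\{f^k\}_{k\in\mathbb{N}}$ if for every $\varepsilon>0$ there is $r_0\in\mathbb{N}$ such that $D(f_r^k,f^k)<\varepsilon$ for all $r\ge r_0$ and all $k\in\mathbb{N}$ (where $f^k$ is the $k$-fold composition of $f$). A set $A\subseteq\mathbb{N}$ is syndetic if there is $M\in\mathbb{N}$ with $\{i,i+1,\dots,i+M\}\cap A\neq\emptyset$ for every $i\in\mathbb{N}$; thick if for every $p\in\mathbb{N}$ there is $n\in\mathbb{N}$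 with $\{n,n+1,\dots,n+p\}\subseteq A$; thickly syndetic if $\{m\in\mathbb{N}: m+j\in A\text{ for }0\le j\le l\}$ is syndetic for every $l\in\mathbb{N}$. The NDS is syndetically (resp. thickly, thickly syndetically) transitive if for any nonempty open $U,V\subseteq X$ the set $\{n\in\mathbb{N}: f_1^n(U)\cap V\neq\emptyset\}$ is syndetic (resp. thick, thickly syndetic). Weakly mixing: for any nonempty open $U_1,U_2,V_1,V_2\subseteq X$ there is $n\in\mathbb{N}$ with $f_1^n(U_1)\cap V_1\neq\emptyset$ and $f_1^n(U_2)\cap V_2\neq\emptyset$. Multi-transitive: for any $m\in\mathbb{N}$ and any nonempty open $U_1,\dots,U_m,V_1,\dots,V_m\subseteq X$ there exists $l\in\mathbb{N}$ with $f_1^{il}(U_i)\cap V_i\neq\emptyset$ for each $i\in\{1,\dots,m\}$. *)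

theory Defs
  imports "HOL-Analysis.Analysis"
begin

text \<open>
  The phase space is a compact subset \<open>X\<close> of a metric space, and all topological notions
  are relative to \<open>X\<close>.  The natural numbers start at 1: index 0 of a sequence of maps is never
  used, and sets of times contain positive numbers only.
\<close>

definition nds :: "'a::metric_space set \<Rightarrow> (nat \<Rightarrow> 'a \<Rightarrow> 'a) \<Rightarrow> bool" where
  "nds X F \<longleftrightarrow> compact X \<and> (\<forall>n\<ge>1. continuous_on X (F n) \<and> F n ` X \<subseteq> X)"

text \<open>\<open>nds_iter F i n\<close> is \<open>F (i + (n - 1)) \<circ> \<dots> \<circ> F i\<close>, with \<open>n\<close> factors.\<close>

primrec nds_iter :: "(nat \<Rightarrow> 'a \<Rightarrow> 'a) \<Rightarrow> nat \<Rightarrow> nat \<Rightarrow> 'a \<Rightarrow> 'a" where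
  "nds_iter F i 0 = id"
| "nds_iter F i (Suc n) = F (i + n) \<circ> nds_iter F i n"

definition nonempty_open_in :: "'a::metric_space set \<Rightarrow> 'a set \<Rightarrow> bool" where
  "nonempty_open_in X U \<longleftrightarrow> openin (top_of_set X) U \<and> U \<noteq> {}"

definition feeble_open :: "'a::metric_space set \<Rightarrow> (nat \<Rightarrow> 'a \<Rightarrow> 'a) \<Rightarrow> bool" where
  "feeble_open X F \<longleftrightarrow>
    (\<forall>U i. nonempty_open_in X U \<and> i \<ge> 1 \<longrightarrow> (top_of_set X) interior_of (F i ` U) \<noteq> {})"

text \<open>The supremum is taken in the reals; it is the genuine one for self-maps of a nonempty
  compact \<open>X\<close>, since then the set of distances is nonempty and bounded.\<close>

definition sup_dist_on :: "'a::metric_space set \<Rightarrow> ('a \<Rightarrow> 'a) \<Rightarrow> ('a \<Rightarrow> 'a) \<Rightarrow> real" where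
  "sup_dist_on X f g = (SUP x\<in>X. dist (f x) (g x))"

definition converges_collectively ::
    "'a::metric_space set \<Rightarrow> (nat \<Rightarrow> 'a \<Rightarrow> 'a) \<Rightarrow> ('a \<Rightarrow> 'a) \<Rightarrow> bool" where
  "converges_collectively X F f \<longleftrightarrow>
    (\<forall>\<epsilon>>0. \<exists>r0\<ge>1. \<forall>r\<ge>r0. \<forall>k\<ge>1. sup_dist_on X (nds_iter F r k) (f ^^ k) < \<epsilon>)"

definition syndetic :: "nat set \<Rightarrow> bool" where
  "syndetic A \<longleftrightarrow> (\<exists>M\<ge>1. \<forall>i\<ge>1. {i..i + M} \<inter> A \<noteq> {})"

definition thick :: "nat set \<Rightarrow> bool" where
  "thick A \<longleftrightarrow> (\<forall>p\<ge>1. \<exists>n\<ge>1. {n..n + p} \<subseteq> A)"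

definition thickly_syndetic :: "nat set \<Rightarrow> bool" where
  "thickly_syndetic A \<longleftrightarrow> (\<forall>l\<ge>1. syndetic {m. m \<ge> 1 \<and> (\<forall>j\<le>l. m + j \<in> A)})"

definition hitting_times :: "(nat \<Rightarrow> 'a \<Rightarrow> 'a) \<Rightarrow> 'a set \<Rightarrow> 'a set \<Rightarrow> nat set" where
  "hitting_times F U V = {n. n \<ge> 1 \<and> nds_iter F 1 n ` U \<inter> V \<noteq> {}}"

definition syndetically_transitive :: "'a::metric_space set \<Rightarrow> (nat \<Rightarrow> 'a \<Rightarrow> 'a) \<Rightarrow> bool" where
  "syndetically_transitive X F \<longleftrightarrow>
    (\<forall>U V. nonempty_open_in X U \<and> nonempty_open_in X V \<longrightarrow> syndetic (hitting_times F U V))"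

definition thickly_transitive :: "'a::metric_space set \<Rightarrow> (nat \<Rightarrow> 'a \<Rightarrow> 'a) \<Rightarrow> bool" where
  "thickly_transitive X F \<longleftrightarrow>
    (\<forall>U V. nonempty_open_in X U \<and> nonempty_open_in X V \<longrightarrow> thick (hitting_times F U V))"

definition thickly_syndetically_transitive ::
    "'a::metric_space set \<Rightarrow> (nat \<Rightarrow> 'a \<Rightarrow> 'a) \<Rightarrow> bool" where
  "thickly_syndetically_transitive X F \<longleftrightarrow>
    (\<forall>U V. nonempty_open_in X U \<and> nonempty_open_in X V \<longrightarrow>
      thickly_syndetic (hitting_times F U V))"

definition weakly_mixing :: "'a::metric_space set \<Rightarrow> (nat \<Rightarrow> 'a \<Rightarrow> 'a) \<Rightarrow> bool" where
  "weakly_mixing X F \<longleftrightarrow>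
    (\<forall>U1 U2 V1 V2. nonempty_open_in X U1 \<and> nonempty_open_in X U2 \<and>
        nonempty_open_in X V1 \<and> nonempty_open_in X V2 \<longrightarrow>
      (\<exists>n\<ge>1. nds_iter F 1 n ` U1 \<inter> V1 \<noteq> {} \<and> nds_iter F 1 n ` U2 \<inter> V2 \<noteq> {}))"

definition multi_transitive :: "'a::metric_space set \<Rightarrow> (nat \<Rightarrow> 'a \<Rightarrow> 'a) \<Rightarrow> bool" where
  "multi_transitive X F \<longleftrightarrow>
    (\<forall>m\<ge>1. \<forall>U V. (\<forall>i\<in>{1..m}. nonempty_open_in X (U i) \<and> nonempty_open_in X (V i)) \<longrightarrow>
      (\<exists>l\<ge>1. \<forall>i\<in>{1..m}. nds_iter F 1 (i * l) ` U i \<inter> V i \<noteq> {}))"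

end

theory Submission
  imports Defs
begin

text \<open>
  Feeble openness and collective convergence make the hitting times of \<open>F\<close> contain a translate of
  hitting times of the autonomous limit \<open>f\<close>, and conversely hitting times of \<open>f\<close> contain a
  translate of those of \<open>F\<close>.  So \<open>f\<close> is weakly mixing and syndetically transitive.  For the
  autonomous \<open>f\<close>, Furstenberg's intersection lemma puts a single set of hitting times, which is
  syndetic, inside any finite intersection of such sets; hence \<open>f\<close>, and then \<open>F\<close>, is thickly
  syndetically transitive.  Multi-transitivity follows because thickly syndetic sets are stable
  under finite intersections and under \<open>A \<mapsto> {l. i * l \<in> A}\<close>.
\<close>

section \<open>Syndetic and thickly syndetic sets\<close>

lemma syndeticI:
  assumes "\<And>i. i \<ge> 1 \<Longrightarrow> \<exists>a\<in>A. i \<le> a \<and> a \<le> i + M"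
  shows "syndetic A"
  unfolding syndetic_def
\<comment> \<open>\<open>M\<close> may be 0 here, while \<open>syndetic\<close> asks for a bound of
  at least 1; hence \<open>Suc M\<close>.\<close>
proof (intro exI[of _ "Suc M"] conjI allI impI)
  fix i :: nat assume "i \<ge> 1"
  from assms[OF this] obtain a where "a \<in> A" "i \<le> a" "a \<le> i + M" by blast
  then have "a \<in> {i..i + Suc M} \<inter> A" by simp
  then show "{i..i + Suc M} \<inter> A \<noteq> {}" by blast
qed simp

lemma syndeticE:
  assumes "syndetic A"
  obtains M where "\<And>i. i \<ge> 1 \<Longrightarrow> \<exists>a\<in>A. i \<le> a \<and> a \<le> i + M"
proof -
  from assms obtain M where M: "\<And>i. i \<ge> 1 \<Longrightarrow> {i..i + M} \<inter> A \<noteq> {}"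
    unfolding syndetic_def by blast
  have "\<exists>a\<in>A. i \<le> a \<and> a \<le> i + M" if "i \<ge> 1" for i
    using M[OF that] by fastforce
  then show ?thesis using that by blast
qed

lemma syndetic_mono: "syndetic A \<Longrightarrow> A \<subseteq> B \<Longrightarrow> syndetic B"
  unfolding syndetic_def by blast

lemma syndetic_unbounded:
  assumes "syndetic A"
  obtains a where "a \<in> A" "a \<ge> N"
proof -
  from syndeticE[OF assms] obtain M
    where M: "\<And>i. i \<ge> 1 \<Longrightarrow> \<exists>a\<in>A. i \<le> a \<and> a \<le> i + M" by blast
  from M[of "Suc N"] show ?thesis using that by fastforce
qed

lemma syndetic_translate_down:
  assumes "syndetic A"
  shows "syndetic {k. k \<ge> 1 \<and> r + k \<in> A}"
proof -
  from syndeticE[OF assms] obtain M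
    where M: "\<And>i. i \<ge> 1 \<Longrightarrow> \<exists>a\<in>A. i \<le> a \<and> a \<le> i + M" by blast
  show ?thesis
  proof (rule syndeticI[of _ M])
    fix i :: nat assume "i \<ge> 1"
    with M[of "r + i"] obtain a where "a \<in> A" "r + i \<le> a" "a \<le> r + i + M" by auto
    with \<open>i \<ge> 1\<close> show "\<exists>k\<in>{k. k \<ge> 1 \<and> r + k \<in> A}. i \<le> k \<and> k \<le> i + M"
      by (intro bexI[of _ "a - r"]) auto
  qed
qed

text \<open>A window of length \<open>M\<close> moved up by \<open>c\<close> stays inside the window
  of length \<open>c + M\<close> with the same start, so only the gap bound grows.\<close>

lemma syndetic_translate_up:
  assumes "syndetic A" and "\<And>a. a \<in> A \<Longrightarrow> c + a \<in> B"
  shows "syndetic B"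
proof -
  from syndeticE[OF assms(1)] obtain M
    where M: "\<And>i. i \<ge> 1 \<Longrightarrow> \<exists>a\<in>A. i \<le> a \<and> a \<le> i + M" by blast
  show ?thesis
  proof (rule syndeticI[of _ "c + M"])
    fix i :: nat assume "i \<ge> 1"
    with M obtain a where "a \<in> A" "i \<le> a" "a \<le> i + M" by blast
    with assms(2) show "\<exists>b\<in>B. i \<le> b \<and> b \<le> i + (c + M)"
      by (intro bexI[of _ "c + a"]) auto
  qed
qed

lemma thick_Int_syndetic:
  assumes "thick A" "syndetic B"
  shows "A \<inter> B \<noteq> {}"
proof -
  from assms(2) obtain M where M: "M \<ge> 1" "\<And>i. i \<ge> 1 \<Longrightarrow> {i..i + M} \<inter> B \<noteq> {}"
    unfolding syndetic_def by blast
  from assms(1) M(1) obtain n where "n \<ge> 1" "{n..n + M} \<subseteq> A"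
    unfolding thick_def by blast
  with M(2) show ?thesis by blast
qed

lemma thickly_syndetic_translate_up:
  assumes "thickly_syndetic A" and "\<And>a. a \<in> A \<Longrightarrow> c + a \<in> B"
  shows "thickly_syndetic B"
  unfolding thickly_syndetic_def
proof (intro allI impI)
  fix l :: nat assume "l \<ge> 1"
  with assms(1) have "syndetic {m. m \<ge> 1 \<and> (\<forall>j\<le>l. m + j \<in> A)}"
    unfolding thickly_syndetic_def by blast
  then show "syndetic {m. m \<ge> 1 \<and> (\<forall>j\<le>l. m + j \<in> B)}"
    by (rule syndetic_translate_up[where c = c]) (auto simp: add.assoc intro: assms(2))
qed

text \<open>Runs for \<open>B\<close> start with gaps at most \<open>M\<close>. A run for
  \<open>A\<close> that is longer by \<open>M\<close> therefore contains a whole run for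
  \<open>B\<close>, and such long runs for \<open>A\<close> are syndetic.\<close>

lemma thickly_syndetic_Int:
  assumes "thickly_syndetic A" "thickly_syndetic B"
  shows "thickly_syndetic (A \<inter> B)"
  unfolding thickly_syndetic_def
proof (intro allI impI)
  fix l :: nat assume l: "l \<ge> 1"
  with assms(2) have "syndetic {m. m \<ge> 1 \<and> (\<forall>j\<le>l. m + j \<in> B)}"
    unfolding thickly_syndetic_def by blast
  from syndeticE[OF this] obtain M where M: "\<And>i. i \<ge> 1 \<Longrightarrow>
      \<exists>m\<in>{m. m \<ge> 1 \<and> (\<forall>j\<le>l. m + j \<in> B)}. i \<le> m \<and> m \<le> i + M" by blast
  from l assms(1) have "syndetic {m. m \<ge> 1 \<and> (\<forall>j\<le>l + M. m + j \<in> A)}"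
    unfolding thickly_syndetic_def by simp
  from syndeticE[OF this] obtain M' where M': "\<And>i. i \<ge> 1 \<Longrightarrow>
      \<exists>m\<in>{m. m \<ge> 1 \<and> (\<forall>j\<le>l + M. m + j \<in> A)}. i \<le> m \<and> m \<le> i + M'" by blast
  show "syndetic {m. m \<ge> 1 \<and> (\<forall>j\<le>l. m + j \<in> A \<inter> B)}"
  proof (rule syndeticI[of _ "M + M'"])
    fix i :: nat assume "i \<ge> 1"
    with M' obtain m where m: "m \<ge> 1" "\<And>j. j \<le> l + M \<Longrightarrow> m + j \<in> A" "i \<le> m" "m \<le> i + M'"
      by blast
    with M obtain m' where m': "\<And>j. j \<le> l \<Longrightarrow> m' + j \<in> B" "m \<le> m'" "m' \<le> m + M"
      by blast
    have "m' + j \<in> A" if "j \<le> l" for j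
      using m(2)[of "m' - m + j"] that m' by simp
    with m m' show "\<exists>m\<in>{m. m \<ge> 1 \<and> (\<forall>j\<le>l. m + j \<in> A \<inter> B)}. i \<le> m \<and> m \<le> i + (M + M')"
      by (intro bexI[of _ m']) auto
  qed
qed

lemma thickly_syndetic_finite_INT:
  assumes "finite I" "I \<noteq> {}" "\<And>i. i \<in> I \<Longrightarrow> thickly_syndetic (A i)"
  shows "thickly_syndetic (\<Inter>i\<in>I. A i)"
  using assms by (induction I rule: finite_ne_induct) (auto intro!: thickly_syndetic_Int)

lemma thickly_syndetic_imp_syndetic:
  assumes "thickly_syndetic A"
  shows "syndetic A"
proof -
  from assms have "syndetic {m. m \<ge> 1 \<and> (\<forall>j\<le>1. m + j \<in> A)}"
    unfolding thickly_syndetic_def by blast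
  then show ?thesis by (rule syndetic_mono) (force dest: spec[of _ 0])
qed

text \<open>A run in \<open>A\<close> reaching up to offset \<open>i * Suc p\<close> contains
  \<open>p + 1\<close> consecutive multiples of \<open>i\<close>. Dividing by \<open>i\<close> does
  not enlarge the gaps, up to rounding.\<close>

lemma thickly_syndetic_divide:
  assumes "thickly_syndetic A" "i \<ge> 1"
  shows "thickly_syndetic {l. i * l \<in> A}"
  unfolding thickly_syndetic_def
proof (intro allI impI)
  fix p :: nat assume "p \<ge> 1"
  have "i * Suc p \<ge> 1" using assms(2) by simp
  with assms(1) have "syndetic {m. m \<ge> 1 \<and> (\<forall>j\<le>i * Suc p. m + j \<in> A)}"
    unfolding thickly_syndetic_def by blast
  from syndeticE[OF this] obtain M where M: "\<And>k. k \<ge> 1 \<Longrightarrow>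
      \<exists>m\<in>{m. m \<ge> 1 \<and> (\<forall>j\<le>i * Suc p. m + j \<in> A)}. k \<le> m \<and> m \<le> k + M" by blast
  show "syndetic {l. l \<ge> 1 \<and> (\<forall>j\<le>p. l + j \<in> {l. i * l \<in> A})}"
  proof (rule syndeticI[of _ "Suc M"])
    fix k :: nat assume k: "k \<ge> 1"
    with assms(2) have "i * k \<ge> 1" by simp
    with M obtain m where m: "\<And>j. j \<le> i * Suc p \<Longrightarrow> m + j \<in> A" "i * k \<le> m" "m \<le> i * k + M"
      by blast
    \<comment> \<open>\<open>i * l\<close> is the first multiple of \<open>i\<close> strictly above
      \<open>m\<close>. It overshoots by at most \<open>i\<close>, which is what
      \<open>Suc p\<close> in place of \<open>p\<close> pays for.\<close>
    define l where "l = Suc (m div i)"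
    have l_gt: "m \<le> i * l" and l_le: "i * l \<le> m + i"
      using assms(2) dividend_less_times_div[of i m] times_div_less_eq_dividend[of i m]
      by (simp_all add: l_def)
    have "i * (l + j) \<in> A" if "j \<le> p" for j
    proof -
      have "i * j \<le> i * p" using that by simp
      with l_gt l_le have "i * (l + j) - m \<le> i * Suc p" "m \<le> i * (l + j)"
        unfolding distrib_left mult_Suc_right by linarith+
      with m(1) show ?thesis by fastforce
    qed
    moreover have "k \<le> m div i"
      using m(2) assms(2) by (simp add: less_eq_div_iff_mult_less_eq mult.commute)
    moreover have "m div i \<le> k + M"
    proof -
      have "m \<le> i * (k + M)"
      proof -
        have "M \<le> i * M" using assms(2) by simp
        with m(3) show ?thesis unfolding distrib_left by linarith
      qed
      from div_le_mono[OF this, of i] assms(2) show ?thesis by simp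
    qed
    ultimately show "\<exists>l\<in>{l. l \<ge> 1 \<and> (\<forall>j\<le>p. l + j \<in> {l. i * l \<in> A})}. k \<le> l \<and> l \<le> k + Suc M"
      by (intro bexI[of _ l]) (auto simp: l_def)
  qed
qed

text \<open>For each \<open>i\<close> the good values of \<open>l\<close> form a thickly syndetic
  set; finitely many such sets have a common element.\<close>

lemma thickly_syndetically_transitive_imp_multi_transitive:
  assumes "thickly_syndetically_transitive X F"
  shows "multi_transitive X F"
  unfolding multi_transitive_def
proof (intro allI impI)
  fix m :: nat and U V :: "nat \<Rightarrow> 'a set"
  assume m: "m \<ge> 1"
    and UV: "\<forall>i\<in>{1..m}. nonempty_open_in X (U i) \<and> nonempty_open_in X (V i)"
  have "thickly_syndetic (\<Inter>i\<in>{1..m}. {l. i * l \<in> hitting_times F (U i) (V i)})"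
  proof (rule thickly_syndetic_finite_INT)
    fix i assume "i \<in> {1..m}"
    with UV assms have "thickly_syndetic (hitting_times F (U i) (V i))"
      unfolding thickly_syndetically_transitive_def by blast
    then show "thickly_syndetic {l. i * l \<in> hitting_times F (U i) (V i)}"
      using \<open>i \<in> {1..m}\<close> by (intro thickly_syndetic_divide) auto
  qed (use m in auto)
  from syndetic_unbounded[OF thickly_syndetic_imp_syndetic[OF this]]
  obtain l where "l \<in> (\<Inter>i\<in>{1..m}. {l. i * l \<in> hitting_times F (U i) (V i)})" "l \<ge> 1" .
  then show "\<exists>l\<ge>1. \<forall>i\<in>{1..m}. nds_iter F 1 (i * l) ` U i \<inter> V i \<noteq> {}"
    unfolding hitting_times_def by blast
qed

section \<open>Iterates and relatively open sets\<close>

lemma nds_iter_add: "nds_iter F i (m + n) = nds_iter F (i + m) n \<circ> nds_iter F i m"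
  by (induction n) (auto simp: fun_eq_iff add.assoc)

text \<open>The limit map is treated as a constant sequence, so that every notion for
  \<open>F\<close> applies to it unchanged.\<close>

lemma nds_iter_const: "nds_iter (\<lambda>_. f) i n = f ^^ n"
  by (induction n) auto

lemma nds_iter_in:
  assumes "nds X F" "i \<ge> 1" "x \<in> X"
  shows "nds_iter F i n x \<in> X"
proof (induction n)
  case (Suc n)
  have "F (i + n) ` X \<subseteq> X" using assms unfolding nds_def by simp
  with Suc show ?case by auto
qed (use assms in simp)

lemma continuous_on_nds_iter:
  assumes "nds X F" "i \<ge> 1"
  shows "continuous_on X (nds_iter F i n)"
proof (induction n)
  case (Suc n)
  have "continuous_on X (F (i + n))" using assms unfolding nds_def by simp
  then have "continuous_on (nds_iter F i n ` X) (F (i + n))"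
    by (rule continuous_on_subset) (use nds_iter_in[OF assms] in auto)
  with Suc show ?case unfolding nds_iter.simps by (rule continuous_on_compose)
qed (simp add: continuous_on_id id_def)

lemma nonempty_open_in_subset: "nonempty_open_in X U \<Longrightarrow> U \<subseteq> X"
  unfolding nonempty_open_in_def using openin_imp_subset by blast

lemma nonempty_open_in_carrier: "nonempty_open_in X U \<Longrightarrow> nonempty_open_in X X"
  using nonempty_open_in_subset[of X U] unfolding nonempty_open_in_def by auto

lemma nonempty_open_in_Int_open:
  assumes "nonempty_open_in X U" "open T" "x \<in> U" "x \<in> T"
  shows "nonempty_open_in X (U \<inter> T)"
  using assms unfolding nonempty_open_in_def by (auto intro: openin_Int_open)

lemma nonempty_open_in_preimage:
  assumes "nds X F" "i \<ge> 1" "nonempty_open_in X U" "nonempty_open_in X V"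
    and "x \<in> U" "nds_iter F i n x \<in> V"
  shows "nonempty_open_in X (U \<inter> nds_iter F i n -` V)"
proof -
  have "openin (top_of_set X) (X \<inter> nds_iter F i n -` V)"
    using assms(1,2,4) nds_iter_in[OF assms(1,2)] unfolding nonempty_open_in_def
    by (intro continuous_openin_preimage[OF continuous_on_nds_iter, where T = X]) auto
  then have "openin (top_of_set X) (U \<inter> (X \<inter> nds_iter F i n -` V))"
    using assms(3) unfolding nonempty_open_in_def by blast
  also have "U \<inter> (X \<inter> nds_iter F i n -` V) = U \<inter> nds_iter F i n -` V"
    using nonempty_open_in_subset[OF assms(3)] by blast
  finally show ?thesis using assms unfolding nonempty_open_in_def by blast
qed

text \<open>Halving the radius of a ball inside \<open>V\<close> leaves a margin \<open>e\<close>,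
  which later absorbs the error between iterates of \<open>F\<close> and of
  \<open>f\<close>.\<close>

lemma nonempty_open_in_shrink:
  assumes "nonempty_open_in X V"
  obtains e V' where "e > 0" "nonempty_open_in X V'"
    "\<And>y z. y \<in> V' \<Longrightarrow> z \<in> X \<Longrightarrow> dist y z < e \<Longrightarrow> z \<in> V"
proof -
  from assms obtain v where v: "v \<in> V" unfolding nonempty_open_in_def by blast
  with assms obtain d where d: "d > 0" "ball v d \<inter> X \<subseteq> V"
    unfolding nonempty_open_in_def by (meson openin_contains_ball)
  show ?thesis
  proof
    show "d / 2 > 0" using d by simp
    show "nonempty_open_in X (V \<inter> ball v (d / 2))"
      using assms v d by (intro nonempty_open_in_Int_open) auto
    fix y z assume "y \<in> V \<inter> ball v (d / 2)" "z \<in> X" "dist y z < d / 2"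
    moreover from this have "dist v z < d"
      using dist_triangle[of v z y] by simp
    ultimately show "z \<in> V" using d by auto
  qed
qed

text \<open>Feeble openness passes to compositions by taking the interior after each map. This
  allows an orbit to be restarted at a late index from an open set.\<close>

lemma feeble_open_nds_iter:
  assumes "feeble_open X F" "nonempty_open_in X U"
  obtains W where "nonempty_open_in X W" "W \<subseteq> nds_iter F 1 n ` U"
proof -
  have "\<exists>W. nonempty_open_in X W \<and> W \<subseteq> nds_iter F 1 n ` U"
  proof (induction n)
    case (Suc n)
    then obtain W where W: "nonempty_open_in X W" "W \<subseteq> nds_iter F 1 n ` U" by blast
    let ?W' = "(top_of_set X) interior_of (F (1 + n) ` W)"
    have "nonempty_open_in X ?W'"
      using assms(1) W(1) unfolding feeble_open_def nonempty_open_in_def by simp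
    moreover have "?W' \<subseteq> F (1 + n) ` W" by (rule interior_of_subset)
    with W(2) have "?W' \<subseteq> nds_iter F 1 (Suc n) ` U"
      unfolding nds_iter.simps image_comp[symmetric] by blast
    ultimately show ?case by blast
  qed (use assms in auto)
  then show ?thesis using that by blast
qed

section \<open>Weak mixing\<close>

lemma weakly_mixingD:
  assumes "weakly_mixing X F" "nonempty_open_in X U1" "nonempty_open_in X U2"
    "nonempty_open_in X V1" "nonempty_open_in X V2"
  obtains n where "n \<in> hitting_times F U1 V1" "n \<in> hitting_times F U2 V2"
proof -
  from assms have "\<exists>n\<ge>1. nds_iter F 1 n ` U1 \<inter> V1 \<noteq> {} \<and> nds_iter F 1 n ` U2 \<inter> V2 \<noteq> {}"
    unfolding weakly_mixing_def by blast
  then show ?thesis using that unfolding hitting_times_def by blast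
qed

text \<open>Take thickness for one pair and syndeticity for the other: a thick set meets every
  syndetic set.\<close>

lemma thick_and_syndetic_imp_weakly_mixing:
  assumes "thickly_transitive X F" "syndetically_transitive X F"
  shows "weakly_mixing X F"
  unfolding weakly_mixing_def
proof (intro allI impI, elim conjE)
  fix U1 U2 V1 V2
  assume "nonempty_open_in X U1" "nonempty_open_in X U2" "nonempty_open_in X V1" "nonempty_open_in X V2"
  then have "hitting_times F U1 V1 \<inter> hitting_times F U2 V2 \<noteq> {}"
    using assms unfolding thickly_transitive_def syndetically_transitive_def
    by (intro thick_Int_syndetic) auto
  then show "\<exists>n\<ge>1. nds_iter F 1 n ` U1 \<inter> V1 \<noteq> {} \<and> nds_iter F 1 n ` U2 \<inter> V2 \<noteq> {}"
    unfolding hitting_times_def by blast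
qed

text \<open>With both source sets equal to \<open>{p}\<close>, a second point of \<open>X\<close>
  would force one orbit point to lie in two disjoint open sets at the same time.\<close>

lemma weakly_mixing_isolated_point:
  assumes "weakly_mixing X F" "nonempty_open_in X {p}"
  shows "X = {p}"
proof (rule ccontr)
  have p: "p \<in> X" using nonempty_open_in_subset[OF assms(2)] by simp
  assume "X \<noteq> {p}"
  with p obtain q where q: "q \<in> X" "q \<noteq> p" by blast
  obtain A B where AB: "open A" "open B" "p \<in> A" "q \<in> B" "A \<inter> B = {}"
    using hausdorff[of p q] q by metis
  have X: "nonempty_open_in X X" using p unfolding nonempty_open_in_def by auto
  obtain n where "n \<in> hitting_times F {p} (X \<inter> A)" "n \<in> hitting_times F {p} (X \<inter> B)"
    using weakly_mixingD[OF assms(1) assms(2) assms(2)]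
      nonempty_open_in_Int_open[OF X AB(1) p AB(3)] nonempty_open_in_Int_open[OF X AB(2) q(1) AB(4)]
    by blast
  with AB(5) show False unfolding hitting_times_def by auto
qed

text \<open>Times are removed one by one. Without isolated points, \<open>V'\<close> has a point
  other than the image of a chosen \<open>x\<close> at time \<open>Suc N\<close>; disjoint
  neighbourhoods of the two points rule that time out.\<close>

lemma avoid_hitting_times_below:
  assumes "nds X F" and perfect: "\<And>p. \<not> nonempty_open_in X {p}"
    and "nonempty_open_in X U" "nonempty_open_in X V"
  shows "\<exists>U'\<subseteq>U. \<exists>V'\<subseteq>V. nonempty_open_in X U' \<and> nonempty_open_in X V' \<and>
    (\<forall>n\<in>hitting_times F U' V'. n > N)"
proof (induction N)
  case 0
  then show ?case using assms unfolding hitting_times_def by auto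
next
  case (Suc N)
  then obtain U' V' where UV: "U' \<subseteq> U" "V' \<subseteq> V" "nonempty_open_in X U'" "nonempty_open_in X V'"
    and *: "\<And>n. n \<in> hitting_times F U' V' \<Longrightarrow> n > N" by blast
  let ?g = "nds_iter F 1 (Suc N)"
  from UV(3) obtain x where x: "x \<in> U'" unfolding nonempty_open_in_def by blast
  have "V' \<noteq> {?g x}" using perfect UV(4) by metis
  moreover have "V' \<noteq> {}" using UV(4) unfolding nonempty_open_in_def by simp
  ultimately obtain y where y: "y \<in> V'" "y \<noteq> ?g x" by fast
  obtain A B where AB: "open A" "open B" "?g x \<in> A" "y \<in> B" "A \<inter> B = {}"
    using hausdorff[of "?g x" y] y by metis
  have X: "nonempty_open_in X X" "?g x \<in> X"
    using nonempty_open_in_carrier[OF UV(3)] x nonempty_open_in_subset[OF UV(3)]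
      nds_iter_in[OF assms(1), of 1 x "Suc N"]
    by auto
  have U'': "nonempty_open_in X (U' \<inter> ?g -` (X \<inter> A))"
    using X AB by (intro nonempty_open_in_preimage[OF assms(1) _ UV(3) _ x] nonempty_open_in_Int_open) auto
  have V'': "nonempty_open_in X (V' \<inter> B)"
    using UV y AB by (intro nonempty_open_in_Int_open) auto
  have "n > Suc N" if "n \<in> hitting_times F (U' \<inter> ?g -` (X \<inter> A)) (V' \<inter> B)" for n
  proof -
    have "n \<in> hitting_times F U' V'" using that unfolding hitting_times_def by blast
    then have "n > N" by (rule *)
    moreover have "n \<noteq> Suc N" using that AB(5) unfolding hitting_times_def by auto
    ultimately show ?thesis by simp
  qed
  with U'' V'' UV show ?case
    by (intro exI[of _ "U' \<inter> ?g -` (X \<inter> A)"] exI[of _ "V' \<inter> B"] conjI) auto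
qed

text \<open>Weak mixing by itself promises only some common time. Without isolated points, shrinking
  the first pair makes early times impossible; with one, the space is a single point and every
  positive time works.\<close>

lemma weakly_mixing_unbounded:
  assumes "nds X F" "weakly_mixing X F" "nonempty_open_in X U1" "nonempty_open_in X U2"
    "nonempty_open_in X V1" "nonempty_open_in X V2"
  obtains n where "n > N" "n \<in> hitting_times F U1 V1" "n \<in> hitting_times F U2 V2"
proof (cases "\<exists>p. nonempty_open_in X {p}")
  case True
  then obtain p where X: "X = {p}" using weakly_mixing_isolated_point[OF assms(2)] by blast
  have "U = {p}" if "nonempty_open_in X U" for U
    using nonempty_open_in_subset[OF that] that X unfolding nonempty_open_in_def by blast
  then have "U1 = {p}" "U2 = {p}" "V1 = {p}" "V2 = {p}" using assms by auto
  moreover have "nds_iter F 1 (Suc N) p = p"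
    using nds_iter_in[OF assms(1), of 1 p "Suc N"] X by simp
  ultimately show ?thesis by (intro that[of "Suc N"]) (auto simp: hitting_times_def)
next
  case False
  then obtain U' V' where UV: "U' \<subseteq> U1" "V' \<subseteq> V1" "nonempty_open_in X U'" "nonempty_open_in X V'"
    and *: "\<And>n. n \<in> hitting_times F U' V' \<Longrightarrow> n > N"
    using avoid_hitting_times_below[OF assms(1) _ assms(3,5), of N] by metis
  obtain n where n: "n \<in> hitting_times F U' V'" "n \<in> hitting_times F U2 V2"
    using weakly_mixingD[OF assms(2) UV(3) assms(4) UV(4) assms(6)] .
  moreover have "n \<in> hitting_times F U1 V1" using n UV unfolding hitting_times_def by blast
  ultimately show ?thesis using * that by blast
qed

section \<open>Autonomous systems\<close>

text \<open>Powers of \<open>f\<close> commute, so applying \<open>f ^^ n\<close> to a visit from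
  \<open>U1\<close> to \<open>V1\<close> at time \<open>k\<close> gives a visit from
  \<open>U2\<close> to \<open>V2\<close> at the same time, once both ends are restricted to points
  that \<open>f ^^ n\<close> sends into \<open>U2\<close> and \<open>V2\<close>.\<close>

lemma furstenberg_intersection:
  assumes "nds X (\<lambda>_. f)" "weakly_mixing X (\<lambda>_. f)"
    "nonempty_open_in X U1" "nonempty_open_in X U2" "nonempty_open_in X V1" "nonempty_open_in X V2"
  shows "\<exists>U V. nonempty_open_in X U \<and> nonempty_open_in X V \<and>
    hitting_times (\<lambda>_. f) U V \<subseteq> hitting_times (\<lambda>_. f) U1 V1 \<inter> hitting_times (\<lambda>_. f) U2 V2"
proof -
  \<comment> \<open>The pairing is crossed: source goes to source and target to target, which makes
    both restricted sets nonempty.\<close>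
  obtain n where "n \<in> hitting_times (\<lambda>_. f) U1 U2" "n \<in> hitting_times (\<lambda>_. f) V1 V2"
    using weakly_mixingD[OF assms(2) assms(3,5) assms(4,6)] .
  then obtain x y where xy: "x \<in> U1" "(f ^^ n) x \<in> U2" "y \<in> V1" "(f ^^ n) y \<in> V2"
    unfolding hitting_times_def nds_iter_const by blast
  have comm: "(f ^^ n) ((f ^^ k) z) = (f ^^ k) ((f ^^ n) z)" for k z
    by (metis add.commute comp_apply funpow_add)
  have "nonempty_open_in X (U1 \<inter> (f ^^ n) -` U2)" "nonempty_open_in X (V1 \<inter> (f ^^ n) -` V2)"
    using nonempty_open_in_preimage[OF assms(1), of 1, unfolded nds_iter_const] assms xy by auto
  moreover have "hitting_times (\<lambda>_. f) (U1 \<inter> (f ^^ n) -` U2) (V1 \<inter> (f ^^ n) -` V2)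
      \<subseteq> hitting_times (\<lambda>_. f) U1 V1 \<inter> hitting_times (\<lambda>_. f) U2 V2"
    unfolding hitting_times_def nds_iter_const by (auto simp: comm)
  ultimately show ?thesis by blast
qed

text \<open>Time \<open>m + j\<close> hits \<open>V\<close> when time \<open>m\<close> hits the
  preimage of \<open>V\<close> under \<open>f ^^ j\<close>. The conditions for
  \<open>j \<le> l\<close> are merged, one at a time, into a single set of hitting times, which is
  syndetic.\<close>

lemma autonomous_thickly_syndetic:
  assumes "nds X (\<lambda>_. f)" "weakly_mixing X (\<lambda>_. f)" "syndetically_transitive X (\<lambda>_. f)"
  shows "thickly_syndetically_transitive X (\<lambda>_. f)"
  unfolding thickly_syndetically_transitive_def thickly_syndetic_def
proof (intro allI impI, elim conjE)
  fix U V and l :: nat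
  assume UV: "nonempty_open_in X U" "nonempty_open_in X V"
  let ?N = "hitting_times (\<lambda>_. f)"
  \<comment> \<open>Nonemptiness comes from an orbit that reaches \<open>V\<close> at some time
    \<open>n \<ge> j\<close>: its point at time \<open>n - j\<close> lies in the preimage.\<close>
  have pre: "nonempty_open_in X (X \<inter> (f ^^ j) -` V)" for j
  proof -
    have "syndetic (?N U V)" using assms(3) UV unfolding syndetically_transitive_def by blast
    from syndetic_unbounded[OF this, of j] obtain n where "n \<in> ?N U V" "j \<le> n" .
    then obtain x where x: "x \<in> U" "(f ^^ n) x \<in> V"
      unfolding hitting_times_def nds_iter_const by blast
    then have "(f ^^ j) ((f ^^ (n - j)) x) \<in> V"
      using \<open>j \<le> n\<close> by (metis comp_apply funpow_add le_add_diff_inverse)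
    moreover have xX: "x \<in> X" using x nonempty_open_in_subset[OF UV(1)] by blast
    have "(f ^^ (n - j)) x \<in> X"
      using nds_iter_in[OF assms(1) _ xX, of 1] by (simp add: nds_iter_const)
    moreover have "nonempty_open_in X X" using xX unfolding nonempty_open_in_def by auto
    ultimately show ?thesis
      using nonempty_open_in_preimage[OF assms(1), of 1, unfolded nds_iter_const] UV by simp
  qed
  have "\<exists>U' V'. nonempty_open_in X U' \<and> nonempty_open_in X V' \<and>
    (\<forall>m\<in>?N U' V'. \<forall>j\<le>l. m + j \<in> ?N U V)"
  proof (induction l)
    case 0
    then show ?case using UV by auto
  next
    case (Suc l)
    then obtain U' V' where *: "nonempty_open_in X U'" "nonempty_open_in X V'"
      "\<forall>m\<in>?N U' V'. \<forall>j\<le>l. m + j \<in> ?N U V" by blast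
    obtain U'' V'' where **: "nonempty_open_in X U''" "nonempty_open_in X V''"
      "?N U'' V'' \<subseteq> ?N U' V' \<inter> ?N U (X \<inter> (f ^^ Suc l) -` V)"
      using furstenberg_intersection[OF assms(1,2) *(1) UV(1) *(2) pre[of "Suc l"]] by blast
    have "m + Suc l \<in> ?N U V" if "m \<in> ?N U (X \<inter> (f ^^ Suc l) -` V)" for m
    proof -
      from that obtain x where "x \<in> U" "(f ^^ Suc l) ((f ^^ m) x) \<in> V"
        unfolding hitting_times_def nds_iter_const by blast
      moreover have "(f ^^ (m + Suc l)) x = (f ^^ Suc l) ((f ^^ m) x)"
        by (metis add.commute comp_apply funpow_add)
      ultimately show ?thesis unfolding hitting_times_def nds_iter_const by auto
    qed
    with * ** show ?case
      by (intro exI[of _ U''] exI[of _ V'']) (auto simp: le_Suc_eq subset_iff)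
  qed
  then obtain U' V' where *: "nonempty_open_in X U'" "nonempty_open_in X V'"
    "\<And>m j. m \<in> ?N U' V' \<Longrightarrow> j \<le> l \<Longrightarrow> m + j \<in> ?N U V" by blast
  have "syndetic (?N U' V')" using assms(3) * unfolding syndetically_transitive_def by blast
  then show "syndetic {m. m \<ge> 1 \<and> (\<forall>j\<le>l. m + j \<in> ?N U V)}"
    by (rule syndetic_mono) (use * in \<open>auto simp: hitting_times_def\<close>)
qed

section \<open>Transfer between a system and its collective limit\<close>

text \<open>The real supremum bounds each distance only if the distances are bounded above;
  \<open>diameter X\<close> provides this by compactness.\<close>

lemma converges_collectivelyD:
  assumes "nds X F" "nds X (\<lambda>_. f)" "converges_collectively X F f" "e > 0"
  obtains r0 where "r0 \<ge> 1"
    "\<And>r k x. r \<ge> r0 \<Longrightarrow> x \<in> X \<Longrightarrow> dist (nds_iter F r k x) ((f ^^ k) x) < e"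
proof -
  from assms obtain r0 where r0: "r0 \<ge> 1"
    "\<And>r k. r \<ge> r0 \<Longrightarrow> k \<ge> 1 \<Longrightarrow> sup_dist_on X (nds_iter F r k) (f ^^ k) < e"
    unfolding converges_collectively_def by blast
  have "dist (nds_iter F r k x) ((f ^^ k) x) < e" if "r \<ge> r0" "x \<in> X" for r k x
  \<comment> \<open>Collective convergence speaks of \<open>k \<ge> 1\<close> only; at
    \<open>k = 0\<close> both maps are the identity.\<close>
  proof (cases "k = 0")
    case True
    then show ?thesis using assms(4) by simp
  next
    case False
    have "bounded X" using assms(1) unfolding nds_def by (simp add: compact_imp_bounded)
    then have "dist (nds_iter F r k y) ((f ^^ k) y) \<le> diameter X" if "y \<in> X" for y
      using that \<open>r \<ge> r0\<close> r0(1) nds_iter_in[OF assms(1), of r y k] nds_iter_in[OF assms(2), of 1 y k]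
      by (intro diameter_bounded_bound) (auto simp: nds_iter_const)
    then have "bdd_above ((\<lambda>y. dist (nds_iter F r k y) ((f ^^ k) y)) ` X)"
      by (intro bdd_aboveI2)
    then have "dist (nds_iter F r k x) ((f ^^ k) x) \<le> sup_dist_on X (nds_iter F r k) (f ^^ k)"
      unfolding sup_dist_on_def using that by (intro cSUP_upper)
    also have "\<dots> < e" using r0 that False by simp
    finally show ?thesis .
  qed
  with r0(1) show ?thesis using that by blast
qed

text \<open>The first \<open>r0\<close> maps carry \<open>U\<close> over an open set
  \<open>U'\<close>. From there the tail of \<open>F\<close> follows \<open>f\<close> within the
  margin around \<open>V'\<close>, uniformly in \<open>k\<close>, so \<open>c = r0\<close>
  works.\<close>

lemma hitting_times_from_limit:
  assumes "nds X F" "nds X (\<lambda>_. f)" "converges_collectively X F f" "feeble_open X F"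
    "nonempty_open_in X U" "nonempty_open_in X V"
  obtains c U' V' where "nonempty_open_in X U'" "nonempty_open_in X V'"
    "\<And>k. k \<in> hitting_times (\<lambda>_. f) U' V' \<Longrightarrow> c + k \<in> hitting_times F U V"
proof -
  obtain e V' where e: "e > 0" "nonempty_open_in X V'"
    "\<And>y z. y \<in> V' \<Longrightarrow> z \<in> X \<Longrightarrow> dist y z < e \<Longrightarrow> z \<in> V"
    using nonempty_open_in_shrink[OF assms(6)] by blast
  obtain r0 where r0: "r0 \<ge> 1"
    "\<And>r k x. r \<ge> r0 \<Longrightarrow> x \<in> X \<Longrightarrow> dist (nds_iter F r k x) ((f ^^ k) x) < e"
    using converges_collectivelyD[OF assms(1-3) e(1)] by blast
  obtain W where W: "nonempty_open_in X W" "W \<subseteq> nds_iter F 1 r0 ` U"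
    using feeble_open_nds_iter[OF assms(4,5)] by blast
  show ?thesis
  proof (rule that[OF W(1) e(2), of r0])
    fix k assume "k \<in> hitting_times (\<lambda>_. f) W V'"
    then obtain w where w: "k \<ge> 1" "w \<in> W" "(f ^^ k) w \<in> V'"
      unfolding hitting_times_def nds_iter_const by blast
    then obtain u where u: "u \<in> U" "w = nds_iter F 1 r0 u" using W(2) by blast
    have "w \<in> X" using w nonempty_open_in_subset[OF W(1)] by blast
    then have "nds_iter F (1 + r0) k w \<in> V"
      using r0(2)[of "1 + r0" w k] nds_iter_in[OF assms(1), of "1 + r0" w k] w
      by (intro e(3)[of "(f ^^ k) w"]) (auto simp: dist_commute)
    then have "nds_iter F 1 (r0 + k) u \<in> V" by (simp add: nds_iter_add u)
    then show "r0 + k \<in> hitting_times F U V" using w u unfolding hitting_times_def by auto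
  qed
qed

text \<open>An orbit of \<open>F\<close> in \<open>U\<close> at time \<open>r\<close> and in
  \<open>V'\<close> at time \<open>r + k\<close> is followed by \<open>f\<close> from time
  \<open>r\<close> on. Since \<open>r0\<close> and \<open>V'\<close> depend on \<open>V\<close>
  alone, \<open>r\<close> can be chosen afterwards to suit \<open>U\<close>.\<close>

lemma hitting_times_to_limit:
  assumes "nds X F" "nds X (\<lambda>_. f)" "converges_collectively X F f" "nonempty_open_in X V"
  obtains r0 V' where "nonempty_open_in X V'"
    "\<And>r k U. r \<ge> r0 \<Longrightarrow> k \<ge> 1 \<Longrightarrow> r + k \<in> hitting_times F (X \<inter> nds_iter F 1 r -` U) V' \<Longrightarrow>
      k \<in> hitting_times (\<lambda>_. f) U V"
proof -
  obtain e V' where e: "e > 0" "nonempty_open_in X V'"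
    "\<And>y z. y \<in> V' \<Longrightarrow> z \<in> X \<Longrightarrow> dist y z < e \<Longrightarrow> z \<in> V"
    using nonempty_open_in_shrink[OF assms(4)] by blast
  obtain r0 where r0: "r0 \<ge> 1"
    "\<And>r k x. r \<ge> r0 \<Longrightarrow> x \<in> X \<Longrightarrow> dist (nds_iter F r k x) ((f ^^ k) x) < e"
    using converges_collectivelyD[OF assms(1-3) e(1)] by blast
  show ?thesis
  proof (rule that[OF e(2), of r0])
    fix r k U
    assume r: "r \<ge> r0" and k: "k \<ge> 1"
      and "r + k \<in> hitting_times F (X \<inter> nds_iter F 1 r -` U) V'"
    then obtain x where x: "x \<in> X" "nds_iter F 1 r x \<in> U" "nds_iter F 1 (r + k) x \<in> V'"
      unfolding hitting_times_def by blast
    define w where "w = nds_iter F 1 r x"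
    have w: "w \<in> X" "w \<in> U" "nds_iter F (1 + r) k w \<in> V'"
      using x nds_iter_in[OF assms(1), of 1 x r] by (simp_all add: w_def nds_iter_add)
    then have "(f ^^ k) w \<in> V"
      using r0(2)[of "1 + r" w k] r nds_iter_in[OF assms(2), of 1 w k]
      by (intro e(3)[of "nds_iter F (1 + r) k w"]) (auto simp: nds_iter_const)
    with w k show "k \<in> hitting_times (\<lambda>_. f) U V"
      unfolding hitting_times_def nds_iter_const by auto
  qed
qed

lemma limit_syndetically_transitive:
  assumes "nds X F" "nds X (\<lambda>_. f)" "converges_collectively X F f" "syndetically_transitive X F"
  shows "syndetically_transitive X (\<lambda>_. f)"
  unfolding syndetically_transitive_def
proof (intro allI impI, elim conjE)
  fix U V assume UV: "nonempty_open_in X U" "nonempty_open_in X V"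
  obtain r0 V' where r0: "nonempty_open_in X V'"
    "\<And>r k U. r \<ge> r0 \<Longrightarrow> k \<ge> 1 \<Longrightarrow> r + k \<in> hitting_times F (X \<inter> nds_iter F 1 r -` U) V' \<Longrightarrow>
      k \<in> hitting_times (\<lambda>_. f) U V"
    by (rule hitting_times_to_limit[OF assms(1-3) UV(2)]) (rule that)
  have X: "nonempty_open_in X X" using UV(1) by (rule nonempty_open_in_carrier)
  have synd: "syndetic (hitting_times F A B)"
    if "nonempty_open_in X A" "nonempty_open_in X B" for A B
    using assms(4) that unfolding syndetically_transitive_def by blast
  \<comment> \<open>A late visit to \<open>U\<close> makes its preimage under the first
    \<open>r\<close> maps nonempty.\<close>
  obtain r where "r \<in> hitting_times F X U" "r \<ge> r0"
    using syndetic_unbounded[OF synd[OF X UV(1)]] .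
  then have "nonempty_open_in X (X \<inter> nds_iter F 1 r -` U)"
    using nonempty_open_in_preimage[OF assms(1) _ X UV(1), of 1] unfolding hitting_times_def by auto
  from syndetic_translate_down[OF synd[OF this r0(1)], of r]
  show "syndetic (hitting_times (\<lambda>_. f) U V)"
    by (rule syndetic_mono) (use r0(2)[OF \<open>r \<ge> r0\<close>] in auto)
qed

text \<open>Weak mixing of \<open>F\<close> is used twice: for a common late time \<open>r\<close>
  at which \<open>U1\<close> and \<open>U2\<close> are both reached, then for a common time
  \<open>n\<close> from their preimages to the shrunken targets. The difference \<open>n - r\<close>
  serves \<open>f\<close>.\<close>

lemma limit_weakly_mixing:
  assumes "nds X F" "nds X (\<lambda>_. f)" "converges_collectively X F f" "weakly_mixing X F"
  shows "weakly_mixing X (\<lambda>_. f)"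
  unfolding weakly_mixing_def
proof (intro allI impI, elim conjE)
  fix U1 U2 V1 V2
  assume UV: "nonempty_open_in X U1" "nonempty_open_in X U2"
    "nonempty_open_in X V1" "nonempty_open_in X V2"
  obtain r1 V1' where r1: "nonempty_open_in X V1'"
    "\<And>r k U. r \<ge> r1 \<Longrightarrow> k \<ge> 1 \<Longrightarrow> r + k \<in> hitting_times F (X \<inter> nds_iter F 1 r -` U) V1' \<Longrightarrow>
      k \<in> hitting_times (\<lambda>_. f) U V1"
    by (rule hitting_times_to_limit[OF assms(1-3) UV(3)]) (rule that)
  obtain r2 V2' where r2: "nonempty_open_in X V2'"
    "\<And>r k U. r \<ge> r2 \<Longrightarrow> k \<ge> 1 \<Longrightarrow> r + k \<in> hitting_times F (X \<inter> nds_iter F 1 r -` U) V2' \<Longrightarrow>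
      k \<in> hitting_times (\<lambda>_. f) U V2"
    by (rule hitting_times_to_limit[OF assms(1-3) UV(4)]) (rule that)
  have X: "nonempty_open_in X X" using UV(1) by (rule nonempty_open_in_carrier)
  obtain r where r: "r > max r1 r2" "r \<in> hitting_times F X U1" "r \<in> hitting_times F X U2"
    using weakly_mixing_unbounded[OF assms(1,4) X X UV(1,2)] .
  have "nonempty_open_in X (X \<inter> nds_iter F 1 r -` U1)" "nonempty_open_in X (X \<inter> nds_iter F 1 r -` U2)"
    using nonempty_open_in_preimage[OF assms(1) _ X UV(1), of 1]
      nonempty_open_in_preimage[OF assms(1) _ X UV(2), of 1] r
    unfolding hitting_times_def by auto
  \<comment> \<open>The strict bound \<open>n > r\<close> ensures that \<open>n - r\<close> is a
    positive time.\<close>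
  then obtain n where n: "n > r" "n \<in> hitting_times F (X \<inter> nds_iter F 1 r -` U1) V1'"
      "n \<in> hitting_times F (X \<inter> nds_iter F 1 r -` U2) V2'"
    using weakly_mixing_unbounded[OF assms(1,4) _ _ r1(1) r2(1)] by blast
  have "n - r \<in> hitting_times (\<lambda>_. f) U1 V1" "n - r \<in> hitting_times (\<lambda>_. f) U2 V2"
    using r1(2)[of r "n - r" U1] r2(2)[of r "n - r" U2] r n by auto
  then show "\<exists>n\<ge>1. nds_iter (\<lambda>_. f) 1 n ` U1 \<inter> V1 \<noteq> {} \<and> nds_iter (\<lambda>_. f) 1 n ` U2 \<inter> V2 \<noteq> {}"
    unfolding hitting_times_def by blast
qed

theorem theorem9:
  fixes X :: "'a::metric_space set"
    and F :: "nat \<Rightarrow> 'a \<Rightarrow> 'a"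
    and f :: "'a \<Rightarrow> 'a"
  assumes "nds X F"
    and "feeble_open X F"
    and "continuous_on X f" and "f ` X \<subseteq> X"
    and "converges_collectively X F f"
    and "syndetically_transitive X F"
    and "weakly_mixing X F \<or> thickly_transitive X F"
  shows "thickly_syndetically_transitive X F \<and> multi_transitive X F"
proof -
  have f: "nds X (\<lambda>_. f)" using assms(1,3,4) unfolding nds_def by simp
  \<comment> \<open>Both alternatives of the hypothesis reduce to weak mixing.\<close>
  have "weakly_mixing X F"
    using assms(6,7) thick_and_syndetic_imp_weakly_mixing by blast
  then have "thickly_syndetically_transitive X (\<lambda>_. f)"
    using assms f
    by (intro autonomous_thickly_syndetic limit_weakly_mixing[of X F] limit_syndetically_transitive[of X F])
  then have lim: "thickly_syndetic (hitting_times (\<lambda>_. f) U V)"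
    if "nonempty_open_in X U" "nonempty_open_in X V" for U V
    using that unfolding thickly_syndetically_transitive_def by blast
  have "thickly_syndetically_transitive X F"
    unfolding thickly_syndetically_transitive_def
  proof (intro allI impI, elim conjE)
    fix U V assume "nonempty_open_in X U" "nonempty_open_in X V"
    \<comment> \<open>Thick syndeticity returns from \<open>f\<close> to \<open>F\<close> because it
      survives the shift by \<open>c\<close>.\<close>
    then obtain c U' V' where "nonempty_open_in X U'" "nonempty_open_in X V'"
      "\<And>k. k \<in> hitting_times (\<lambda>_. f) U' V' \<Longrightarrow> c + k \<in> hitting_times F U V"
      by (rule hitting_times_from_limit[OF assms(1) f assms(5,2)]) (rule that)
    then show "thickly_syndetic (hitting_times F U V)"
      using lim thickly_syndetic_translate_up by blast
  qed
  then show ?thesis using thickly_syndetically_transitive_imp_multi_transitive by blast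
qed

end
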